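(* Let $m\ge 1$ be an integer, let $\Sigma=\{\sigma_{ij}\}$ be an $m\times m$ (symmetric) positive semidefinite matrix with $\sigma_{jj}>0$ for all $j=1,\ldots,m$, and let $X=(X_1,\ldots,X_m)\sim \mathrm{N}(0,\Sigma)$. Let $q(x_1,\ldots,x_m)=x_1^{a_1}\cdots x_m^{a_m}$ with non-negative real exponents $a_1,\ldots,a_m$ such that $\sum_{j=1}^m a_j>0$. Then $$W_{q,\Sigma}(X)\ \sim\ \frac{1}{\left(\sum_{j=1}^m a_j\right)^2}\,\chi^2_1 .$$
   Context: $\mathrm{N}(0,\Sigma)$ denotes the (possibly degenerate) centered multivariate Gaussian distribution on $\mathbb{R}^m$ with covariance matrix $\Sigma$; $\Sigma$ may be singular. $\chi^2_1$ denotes a chi-squared random variable with $1$ degree of freedom, and the conclusion is equality in distribution. The Wald statistic is defined by $$W_{q,\Sigma}(x)=\frac{q^2(x)}{\nabla q(x)\,\Sigma\,\nabla^{\top}q(x)}\equiv\left\{\nabla[\log q(x)]\,\Sigma\,\nabla^{\top}[\log q(x)]\right\}^{-1},$$ where gradients are row vectors. For $q(x_1,\ldots,x_m)=x_1^{a_1}\cdots x_m^{a_m}$ one takes $\nabla\log q(x)=\left(\frac{a_1}{x_1},\ldots,\frac{a_m}{x_m}\right)$, so that, for $x$ with all coordinates nonzero, $$W_{q,\Sigma}(x)=\left\{\sum_{i=1}^m\sum_{j=1}^m \frac{a_i a_j\sigma_{ij}}{x_i x_j}\right\}^{-1};$$ this last expression is the meaning of $W_{q,\Sigma}(x)$ also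 when non-integer exponents $a_j$ and negative coordinates $x_j$ occur. *)

theory Defs
  imports "HOL-Probability.Probability"
begin

definition pos_semidef :: "real^'m^'m \<Rightarrow> bool" where
  "pos_semidef \<Sigma> \<longleftrightarrow> transpose \<Sigma> = \<Sigma> \<and> (\<forall>v. 0 \<le> v \<bullet> (\<Sigma> *v v))"

text \<open>
  The distribution \<open>N(0,\<Sigma>)\<close> is given by its characteristic function, which makes sense
  for singular \<open>\<Sigma>\<close> as well; no density is required.
\<close>

definition centered_gaussian :: "real^'m^'m \<Rightarrow> (real^'m) measure \<Rightarrow> bool" where
  "centered_gaussian \<Sigma> N \<longleftrightarrow>
     prob_space N \<and> sets N = sets borel \<and>
     (\<forall>t. (CLINT x|N. iexp (t \<bullet> x)) = exp (- complex_of_real (t \<bullet> (\<Sigma> *v t)) / 2))"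

definition chi_squared :: "nat \<Rightarrow> real measure" where
  "chi_squared k =
     distr (\<Pi>\<^sub>M i\<in>{..<k}. density lborel (\<lambda>x. ennreal (std_normal_density x))) borel
       (\<lambda>z. \<Sum>i<k. (z i)\<^sup>2)"

definition gradient :: "(real^'m \<Rightarrow> real) \<Rightarrow> real^'m \<Rightarrow> real^'m" where
  "gradient q x = (\<chi> i. frechet_derivative q (at x) (axis i 1))"

definition wald :: "(real^'m \<Rightarrow> real) \<Rightarrow> real^'m^'m \<Rightarrow> real^'m \<Rightarrow> real" where
  "wald q \<Sigma> x = (q x)\<^sup>2 / (gradient q x \<bullet> (\<Sigma> *v gradient q x))"

text \<open>
  The Wald statistic of \<open>q x = (\<Prod>j\<in>UNIV. x$j powr a$j)\<close>, written with the logarithmic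
  gradient \<open>a$i / x$i\<close> so that it is meaningful for real exponents and negative coordinates,
  where \<open>q\<close> itself need not be defined. The lemmas below relate it to \<open>wald\<close>. If some
  coordinate of \<open>x\<close> is 0, its value is an artefact of \<open>u / 0 = 0\<close>.
\<close>

definition wald_monomial :: "real^'m \<Rightarrow> real^'m^'m \<Rightarrow> real^'m \<Rightarrow> real" where
  "wald_monomial a \<Sigma> x =
     inverse (\<Sum>i\<in>UNIV. \<Sum>j\<in>UNIV. a$i * a$j * \<Sigma>$i$j / (x$i * x$j))"

lemma wald_eq_wald_monomial:
  fixes q :: "real^'m \<Rightarrow> real"
  assumes "q x \<noteq> 0" and "\<And>i. gradient q x $ i = q x * (a$i / x$i)"
  shows "wald q \<Sigma> x = wald_monomial a \<Sigma> x"
proof -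
  have "gradient q x \<bullet> (\<Sigma> *v gradient q x)
      = (q x)\<^sup>2 * (\<Sum>i\<in>UNIV. \<Sum>j\<in>UNIV. a$i * a$j * \<Sigma>$i$j / (x$i * x$j))"
    by (simp add: inner_vec_def matrix_vector_mult_def assms(2) sum_distrib_left
        power2_eq_square mult_ac)
  then show ?thesis
    using assms(1) by (simp add: wald_def wald_monomial_def divide_inverse)
qed

lemma gradient_prod:
  fixes f :: "'m::finite \<Rightarrow> real \<Rightarrow> real"
  assumes "\<And>j. (f j has_real_derivative d j) (at (x$j))"
  shows "gradient (\<lambda>x. \<Prod>j\<in>UNIV. f j (x$j)) x $ i = d i * (\<Prod>j\<in>UNIV - {i}. f j (x$j))"
proof -
  have 1: "((\<lambda>x. f j (x$j)) has_derivative (\<lambda>h. d j * h$j)) (at x)" for j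
  proof -
    have "((\<lambda>x. x$j) has_derivative (\<lambda>h. h$j)) (at x)"
      by (intro bounded_linear.has_derivative[OF bounded_linear_vec_nth] has_derivative_ident)
    from has_derivative_compose[OF this assms[of j, unfolded has_field_derivative_def]]
    show ?thesis by simp
  qed
  have "((\<lambda>x. \<Prod>j\<in>UNIV. f j (x$j)) has_derivative
      (\<lambda>h. \<Sum>k\<in>UNIV. (d k * h$k) * (\<Prod>j\<in>UNIV - {k}. f j (x$j)))) (at x)"
    by (rule has_derivative_prod) (rule 1)
  then have "frechet_derivative (\<lambda>x. \<Prod>j\<in>UNIV. f j (x$j)) (at x)
      = (\<lambda>h. \<Sum>k\<in>UNIV. (d k * h$k) * (\<Prod>j\<in>UNIV - {k}. f j (x$j)))"
    by (rule frechet_derivative_at[symmetric])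
  then show ?thesis
    by (simp add: gradient_def axis_def if_distrib[of "\<lambda>u. _ * u"] if_distrib[of "\<lambda>u. u * _"]
        sum.delta cong: if_cong)
qed

lemma wald_powr:
  fixes x a :: "real^'m"
  assumes "\<And>j. 0 < x$j"
  shows "wald (\<lambda>x. \<Prod>j\<in>UNIV. x$j powr a$j) \<Sigma> x = wald_monomial a \<Sigma> x"
proof (rule wald_eq_wald_monomial)
  show "(\<Prod>j\<in>UNIV. x$j powr a$j) \<noteq> 0"
    using assms by (auto simp: less_le)
  fix i
  have "((\<lambda>y. y powr a$j) has_real_derivative a$j * x$j powr (a$j - 1)) (at (x$j))" for j
    using assms[of j] by (rule has_real_derivative_powr)
  from gradient_prod[of "\<lambda>j y. y powr a$j", OF this]
  have "gradient (\<lambda>x. \<Prod>j\<in>UNIV. x$j powr a$j) x $ i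
      = a$i * x$i powr (a$i - 1) * (\<Prod>j\<in>UNIV - {i}. x$j powr a$j)" .
  also have "\<dots> = x$i powr a$i * (\<Prod>j\<in>UNIV - {i}. x$j powr a$j) * (a$i / x$i)"
    using assms[of i] by (simp add: powr_diff)
  also have "\<dots> = (\<Prod>j\<in>UNIV. x$j powr a$j) * (a$i / x$i)"
    by (subst prod.remove[of UNIV i]) auto
  finally show "gradient (\<lambda>x. \<Prod>j\<in>UNIV. x$j powr a$j) x $ i
      = (\<Prod>j\<in>UNIV. x$j powr a$j) * (a$i / x$i)" .
qed

lemma wald_power:
  fixes x :: "real^'m" and n :: "'m \<Rightarrow> nat"
  assumes "\<And>j. x$j \<noteq> 0"
  shows "wald (\<lambda>x. \<Prod>j\<in>UNIV. x$j ^ n j) \<Sigma> x = wald_monomial (\<chi> j. real (n j)) \<Sigma> x"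
proof (rule wald_eq_wald_monomial)
  show "(\<Prod>j\<in>UNIV. x$j ^ n j) \<noteq> 0"
    using assms by auto
  fix i
  have "((\<lambda>y. y ^ n j) has_real_derivative real (n j) * x$j ^ (n j - 1)) (at (x$j))" for j
    using DERIV_pow[of "n j" "x$j"] by simp
  from gradient_prod[of "\<lambda>j y. y ^ n j", OF this]
  have "gradient (\<lambda>x. \<Prod>j\<in>UNIV. x$j ^ n j) x $ i
      = real (n i) * x$i ^ (n i - 1) * (\<Prod>j\<in>UNIV - {i}. x$j ^ n j)" .
  also have "\<dots> = x$i ^ n i * (\<Prod>j\<in>UNIV - {i}. x$j ^ n j) * (real (n i) / x$i)"
    using assms[of i] by (cases "n i") auto
  also have "\<dots> = (\<Prod>j\<in>UNIV. x$j ^ n j) * (real (n i) / x$i)"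
    by (subst prod.remove[of UNIV i]) auto
  finally show "gradient (\<lambda>x. \<Prod>j\<in>UNIV. x$j ^ n j) x $ i
      = (\<Prod>j\<in>UNIV. x$j ^ n j) * ((\<chi> j. real (n j))$i / x$i)" by simp
qed

end

theory Submission
  imports Defs "HOL-Complex_Analysis.Cauchy_Integral_Formula"
begin

text \<open>
  Write \<open>S = 1 / W\<close> for the reciprocal Wald statistic and \<open>A\<close> for the sum of the exponents. With
  \<open>w(x)\<close> the vector of the \<open>a$j / x$j\<close>, \<open>S(x)\<close> is the quadratic form of \<open>\<Sigma>\<close> at \<open>w(x)\<close>. Let \<open>Y\<close> be an
  independent copy of \<open>X\<close>. Given \<open>X = x\<close>, the ratio sum \<open>T = (\<Sum>j. a$j * Y$j / X$j)\<close> is a centered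
  Gaussian of variance \<open>S(x)\<close>, so that the characteristic function of \<open>T\<close> at \<open>t\<close> is the Laplace
  transform of \<open>S(X)\<close> at \<open>t\<^sup>2 / 2\<close>.

  On the other hand \<open>T\<close> has a Cauchy distribution. The law of \<open>(X, Y)\<close> is invariant under the
  rotations that act on every pair \<open>(X$j, Y$j)\<close> by the same angle
  (\<open>gaussian_pair_rotation_invariant\<close>), so one may average over the angle first. Rotation by \<open>u\<close>
  turns \<open>\<i> * Y$j / X$j\<close> into \<open>(z * b - 1) / (z * b + 1)\<close> with \<open>z = exp (2 * \<i> * u)\<close> and a unimodular
  \<open>b\<close> that depends on the pair. This Moebius map sends the unit disc into the left half-plane. Hence
  \<open>exp (\<i> * t * T)\<close> is, as a function of the angle, the boundary value of a bounded holomorphic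
  function of \<open>z\<close> in the disc, and its mean over the circle is the value at \<open>z = 0\<close>, namely
  \<open>exp (- t * A)\<close>, for all values of \<open>X\<close> and \<open>Y\<close> for which no \<open>X$j\<close> vanishes
  (\<open>circle_mean_exp_moebius\<close>, \<open>mean_rotated_ratio\<close>).

  Thus the Laplace transform of \<open>S(X)\<close> at \<open>t\<^sup>2 / 2\<close> is \<open>exp (- t * A)\<close> (\<open>laplace_inverse_wald\<close>), and it
  depends on \<open>\<Sigma>\<close> and \<open>a\<close> only through \<open>A\<close>. In particular it is the same as in dimension one with a
  standard normal \<open>Z\<close> and the single exponent \<open>A\<close>, where \<open>W = Z\<^sup>2 / A\<^sup>2\<close>. Since a Laplace transform
  determines a distribution on the nonnegative reals (\<open>distr_eq_if_laplace_eq\<close>), the theorem follows.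
\<close>

section \<open>Characteristic functions in Euclidean spaces\<close>

text \<open>
  This is uniqueness of the characteristic function on the line, applied to the image under \<open>f\<close> of
  the measure with density \<open>h\<close>, which becomes a probability measure after division by its mass.
\<close>

lemma weighted_char_unique:
  fixes f h :: "'a::topological_space \<Rightarrow> real"
  assumes M: "prob_space M" "sets M = sets borel" and N: "prob_space N" "sets N = sets borel"
    and h[measurable]: "h \<in> borel_measurable borel" and h0: "\<And>x. 0 \<le> h x" and hB: "\<And>x. h x \<le> B"
    and f[measurable]: "f \<in> borel_measurable borel"
    and eq: "\<And>s. (CLINT x|M. h x * iexp (s * f x)) = (CLINT x|N. h x * iexp (s * f x))"
    and A[measurable]: "A \<in> sets borel"
  shows "(LINT x|M. h x * indicator A (f x)) = (LINT x|N. h x * indicator A (f x))"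
proof -
  define m where "m = (LINT x|M. h x)"
  note [measurable_cong] = M(2) N(2)
  interpret M: prob_space M by fact
  interpret N: prob_space N by fact
  have iM: "integrable M h" and iN: "integrable N h"
    using h0 hB by (auto intro!: M.integrable_const_bound[of _ B] N.integrable_const_bound[of _ B])
  have "complex_of_real (LINT x|M. h x) = complex_of_real (LINT x|N. h x)"
    using eq[of 0] by (simp flip: integral_complex_of_real)
  then have mN: "m = (LINT x|N. h x)" by (simp add: m_def)
  show ?thesis
  proof (cases "m = 0")
    case True
    have "AE x in M. h x = 0" "AE x in N. h x = 0"
      using integral_nonneg_eq_0_iff_AE[OF iM] integral_nonneg_eq_0_iff_AE[OF iN] h0 True mN
      by (auto simp: m_def)
    then have "(LINT x|M. h x * indicator A (f x)) = 0" "(LINT x|N. h x * indicator A (f x)) = 0"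
      by (auto intro!: integral_eq_zero_AE)
    then show ?thesis by simp
  next
    case False
    moreover have "0 \<le> m" unfolding m_def using h0 by (intro integral_nonneg_AE) auto
    ultimately have m: "m > 0" by simp
    define D where "D K = distr (density K (\<lambda>x. h x / m)) borel f" for K :: "'a measure"
    have D: "real_distribution (D K)" and cD: "char (D K) s = (CLINT x|K. h x * iexp (s * f x)) / m"
      and iD: "(LINT y|D K. indicator A y) = (LINT x|K. h x * indicator A (f x)) / m"
      if K: "sets K = sets borel" and i: "integrable K h" and l: "(LINT x|K. h x) = m" for K s
    proof -
      note [measurable_cong] = K
      have "emeasure (density K (\<lambda>x. ennreal (h x / m))) (space K) = ennreal (LINT x|K. h x / m)"
        using i m h0 by (subst emeasure_density) (auto simp: nn_integral_eq_integral)
      also have "\<dots> = 1" using l m by simp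
      finally have "prob_space (density K (\<lambda>x. ennreal (h x / m)))"
        by (intro prob_spaceI) simp
      then interpret dK: prob_space "density K (\<lambda>x. ennreal (h x / m))" .
      show "real_distribution (D K)" unfolding D_def by (rule dK.real_distribution_distr) simp
      have "char (D K) s = (CLINT x|K. (h x / m) *\<^sub>R iexp (s * f x))"
        unfolding char_def D_def using m h0
        by (subst integral_distr, simp, simp, subst integral_density) auto
      also have "\<dots> = (CLINT x|K. (h x * iexp (s * f x)) / m)"
        by (simp add: scaleR_conv_of_real)
      finally show "char (D K) s = (CLINT x|K. h x * iexp (s * f x)) / m"
        by simp
      have "(LINT y|D K. indicator A y :: real) = (LINT x|K. (h x / m) *\<^sub>R indicator A (f x))"
        unfolding D_def using m h0
        by (subst integral_distr, simp, simp, subst integral_density) auto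
      then show "(LINT y|D K. indicator A y) = (LINT x|K. h x * indicator A (f x)) / m"
        by simp
    qed
    have "D M = D N"
      using iM iN mN M(2) N(2) m_def eq by (intro Levy_uniqueness D ext) (auto simp: cD)
    with iD[OF M(2) iM] iD[OF N(2) iN] m mN m_def show ?thesis by (metis divide_cancel_right less_irrefl)
  qed
qed

text \<open>
  Indicators of the coordinates can be inserted one at a time under the Fourier transform. The
  transform of \<open>g\<close> determines all integrals of \<open>g\<close> against exponentials, and hence those of
  \<open>g x * (1 + cos (t \<bullet> x + c)) * iexp (s * (k \<bullet> x))\<close>. Here \<open>g x * (1 + cos (t \<bullet> x + c))\<close> is a nonnegative
  weight, so the exponential in \<open>k \<bullet> x\<close> may be exchanged for an indicator of \<open>k \<bullet> x\<close>; subtracting the case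
  of weight \<open>g\<close> leaves the cosine. The phases \<open>c = 0\<close> and \<open>c = - pi / 2\<close> give the real and the imaginary part of
  \<open>iexp (t \<bullet> x)\<close>.
\<close>

lemma char_unique_coord_step:
  fixes g :: "'a::euclidean_space \<Rightarrow> real"
  assumes M: "prob_space M" "sets M = sets borel" and N: "prob_space N" "sets N = sets borel"
    and g[measurable]: "g \<in> borel_measurable borel" and g0: "\<And>x. 0 \<le> g x" and gB: "\<And>x. g x \<le> 1"
    and eq: "\<And>t. (CLINT x|M. g x * iexp (t \<bullet> x)) = (CLINT x|N. g x * iexp (t \<bullet> x))"
    and A[measurable]: "A \<in> sets borel"
  shows "(CLINT x|M. complex_of_real (g x * indicator A (k \<bullet> x)) * iexp (t \<bullet> x))
       = (CLINT x|N. complex_of_real (g x * indicator A (k \<bullet> x)) * iexp (t \<bullet> x))"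
proof -
  note [measurable_cong] = M(2) N(2)
  interpret M: prob_space M by fact
  interpret N: prob_space N by fact
  have gB': "\<bar>g x\<bar> \<le> 1" for x using g0 gB by (auto simp: abs_le_iff)
  have intc: "integrable K (\<lambda>x. complex_of_real (g x) * iexp (v \<bullet> x))"
    if "prob_space K" "sets K = sets borel" for K v
  proof -
    note [measurable_cong] = that(2)
    interpret K: prob_space K by fact
    show ?thesis
      using gB' by (intro K.integrable_const_bound[of _ 1]) (auto simp: norm_mult)
  qed
  have intr: "integrable K (\<lambda>x. g x * indicator A (k \<bullet> x) * cos (t \<bullet> x + c))"
    if "prob_space K" "sets K = sets borel" for K c
  proof -
    note [measurable_cong] = that(2)
    interpret K: prob_space K by fact
    show ?thesis
      using gB' by (intro K.integrable_const_bound[of _ 1])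
         (auto simp: abs_mult indicator_def intro!: mult_le_one AE_I2)
  qed
  have int0: "integrable K (\<lambda>x. g x * indicator A (k \<bullet> x))"
    if "prob_space K" "sets K = sets borel" for K
  proof -
    note [measurable_cong] = that(2)
    interpret K: prob_space K by fact
    show ?thesis
      using gB' by (intro K.integrable_const_bound[of _ 1])
         (auto simp: abs_mult indicator_def intro!: mult_le_one AE_I2)
  qed
  have expand: "(CLINT x|K. complex_of_real (g x * (1 + cos (t \<bullet> x + c))) * iexp (s * (k \<bullet> x)))
      = (CLINT x|K. g x * iexp ((s *\<^sub>R k) \<bullet> x))
      + (iexp c / 2) * (CLINT x|K. g x * iexp ((s *\<^sub>R k + t) \<bullet> x))
      + (iexp (-c) / 2) * (CLINT x|K. g x * iexp ((s *\<^sub>R k - t) \<bullet> x))"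
    if "prob_space K" "sets K = sets borel" for K s c
  proof -
    have p: "complex_of_real (g x * (1 + cos (t \<bullet> x + c))) * iexp (s * (k \<bullet> x))
       = (g x * iexp ((s *\<^sub>R k) \<bullet> x))
      + (iexp c / 2) * (g x * iexp ((s *\<^sub>R k + t) \<bullet> x))
      + (iexp (-c) / 2) * (g x * iexp ((s *\<^sub>R k - t) \<bullet> x))" for x
    proof -
      have "complex_of_real (cos (t \<bullet> x + c)) = (iexp (t \<bullet> x) * iexp c + iexp (-(t \<bullet> x)) * iexp (-c)) / 2"
        by (simp add: cos_of_real[symmetric] cos_exp_eq exp_add[symmetric] algebra_simps del: cos_of_real)
      moreover have "iexp ((s *\<^sub>R k + t) \<bullet> x) = iexp (s * (k \<bullet> x)) * iexp (t \<bullet> x)"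
        "iexp ((s *\<^sub>R k - t) \<bullet> x) = iexp (s * (k \<bullet> x)) * iexp (-(t \<bullet> x))"
        by (simp_all add: inner_add_left inner_diff_left exp_add[symmetric] algebra_simps)
      moreover have "G * (1 + (E2 * C + E3 * C') / 2) * E1
          = G * E1 + C / 2 * (G * (E1 * E2)) + C' / 2 * (G * (E1 * E3))" for G E1 E2 E3 C C' :: complex
        by (simp add: field_simps)
      ultimately show ?thesis by (simp only: of_real_mult of_real_add of_real_1 inner_scaleR_left)
    qed
    show ?thesis unfolding p
      by (simp add: intc that del: inner_scaleR_left)
  qed
  have c: "(LINT x|M. g x * indicator A (k \<bullet> x) * cos (t \<bullet> x + c))
     = (LINT x|N. g x * indicator A (k \<bullet> x) * cos (t \<bullet> x + c))" for c
  proof -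
    have 1: "(LINT x|M. g x * (1 + cos (t \<bullet> x + c)) * indicator A (k \<bullet> x))
     = (LINT x|N. g x * (1 + cos (t \<bullet> x + c)) * indicator A (k \<bullet> x))"
    proof (rule weighted_char_unique[OF M N _ _ _ _ _ A, where B=2])
      show "0 \<le> g x * (1 + cos (t \<bullet> x + c))" for x
        using mult_nonneg_nonneg[OF g0[of x], of "1 + cos (t \<bullet> x + c)"] cos_ge_minus_one[of "t \<bullet> x + c"] by simp
      show "g x * (1 + cos (t \<bullet> x + c)) \<le> 2" for x
        using mult_mono[OF gB[of x], of "1 + cos (t \<bullet> x + c)" 2] g0[of x] cos_ge_minus_one[of "t \<bullet> x + c"] by simp
    qed (auto simp only: expand M N eq, auto)
    have 2: "(LINT x|M. g x * indicator A (k \<bullet> x)) = (LINT x|N. g x * indicator A (k \<bullet> x))"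
      using eq[of "s *\<^sub>R k" for s] by (intro weighted_char_unique[OF M N _ g0 gB _ _ A]) auto
    have 3: "g x * (1 + cos (t \<bullet> x + c)) * indicator A (k \<bullet> x)
        = g x * indicator A (k \<bullet> x) + g x * indicator A (k \<bullet> x) * cos (t \<bullet> x + c)" for x
      by (simp add: algebra_simps)
    show ?thesis
      using 1 2 unfolding 3 by (simp add: Bochner_Integration.integral_add intr int0 M N)
  qed
  have split: "(CLINT x|K. complex_of_real (g x * indicator A (k \<bullet> x)) * iexp (t \<bullet> x))
     = complex_of_real (LINT x|K. g x * indicator A (k \<bullet> x) * cos (t \<bullet> x + 0))
      + \<i> * complex_of_real (LINT x|K. g x * indicator A (k \<bullet> x) * cos (t \<bullet> x + (- pi/2)))"
    if "prob_space K" "sets K = sets borel" for K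
  proof -
    have p: "complex_of_real (g x * indicator A (k \<bullet> x)) * iexp (t \<bullet> x)
       = complex_of_real (g x * indicator A (k \<bullet> x) * cos (t \<bullet> x + 0))
      + \<i> * complex_of_real (g x * indicator A (k \<bullet> x) * cos (t \<bullet> x + (- pi/2)))" for x
      by (simp add: cis_conv_exp[symmetric] complex_eq_iff cos_add cos_diff)
    have lin: "(CLINT x|K. complex_of_real (u x) + \<i> * complex_of_real (v x))
        = complex_of_real (LINT x|K. u x) + \<i> * complex_of_real (LINT x|K. v x)"
      if "integrable K u" "integrable K v" for u v
      using that by simp
    show ?thesis unfolding p by (rule lin[OF intr[OF that] intr[OF that]])
  qed
  show ?thesis unfolding split[OF M] split[OF N] c ..
qed

text \<open>
  Starting from the constant weight 1, insert an indicator for each basis vector. At frequency 0 this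
  gives the measure of boxes, which generate the Borel sets and are closed under intersection.
\<close>

theorem char_unique_euclidean:
  fixes M N :: "'a::euclidean_space measure"
  assumes M: "prob_space M" "sets M = sets borel" and N: "prob_space N" "sets N = sets borel"
    and eq: "\<And>t. (CLINT x|M. iexp (t \<bullet> x)) = (CLINT x|N. iexp (t \<bullet> x))"
  shows "M = N"
proof -
  note [measurable_cong] = M(2) N(2)
  interpret M: prob_space M by fact
  interpret N: prob_space N by fact
  have *: "(CLINT x|M. complex_of_real (\<Prod>k\<in>S. indicator (A k) (k \<bullet> x)) * iexp (t \<bullet> x))
     = (CLINT x|N. complex_of_real (\<Prod>k\<in>S. indicator (A k) (k \<bullet> x)) * iexp (t \<bullet> x))"
    if "finite S" "\<And>k. A k \<in> sets borel" for S t and A :: "'a \<Rightarrow> real set"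
    using that(1)
  proof (induction S arbitrary: t)
    case empty then show ?case using eq by simp
  next
    case (insert k S)
    note [measurable] = that(2)
    have "(CLINT x|M. complex_of_real ((\<Prod>k\<in>S. indicator (A k) (k \<bullet> x)) * indicator (A k) (k \<bullet> x)) * iexp (t \<bullet> x))
       = (CLINT x|N. complex_of_real ((\<Prod>k\<in>S. indicator (A k) (k \<bullet> x)) * indicator (A k) (k \<bullet> x)) * iexp (t \<bullet> x))"
      using insert.IH
      by (intro char_unique_coord_step[OF M N]) (auto intro!: prod_nonneg prod_le_1 simp: that)
    then show ?case using insert.hyps by (simp add: mult.commute)
  qed
  have box: "emeasure M (box a b) = emeasure N (box a b)" for a b
  proof -
    have ind: "(\<Prod>k\<in>Basis. indicator {a \<bullet> k<..<b \<bullet> k} (k \<bullet> x)) = (indicator (box a b) x :: real)" for x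
      by (auto simp: box_def inner_commute indicator_def prod.If_cases Ball_def)
    have "complex_of_real (measure M (box a b)) = complex_of_real (measure N (box a b))"
      using *[of Basis "\<lambda>k. {a \<bullet> k<..<b \<bullet> k}" 0] unfolding ind
      by (simp add: M(2) N(2))
    then show ?thesis by (simp add: M.emeasure_eq_measure N.emeasure_eq_measure)
  qed
  show ?thesis
  proof (rule measure_eqI_generator_eq[where E="range (\<lambda>(a,b). box a b)" and \<Omega>=UNIV
        and A="\<lambda>n. box (- real n *\<^sub>R One) (real n *\<^sub>R One)"])
    show "Int_stable (range (\<lambda>(a, b). box a b :: 'a set))"
      by (auto simp: Int_stable_def box_Int_box)
    show "sets M = sigma_sets UNIV (range (\<lambda>(a,b). box a b))"
        "sets N = sigma_sets UNIV (range (\<lambda>(a,b). box a b))"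
      by (simp_all add: M N borel_eq_box)
    show "(\<Union>n. box (- real n *\<^sub>R One) (real n *\<^sub>R One)) = (UNIV :: 'a set)"
      unfolding UN_box_eq_UNIV[symmetric] by simp
  qed (auto simp: box)
qed

section \<open>A mean value over the circle\<close>

lemma Re_moebius_nonpos:
  fixes w :: complex
  assumes "norm w \<le> 1"
  shows "Re ((w - 1) / (w + 1)) \<le> 0"
proof -
  have "(norm w)\<^sup>2 \<le> 1" using assms by (simp add: power_le_one_iff)
  then have "(Re w)\<^sup>2 + (Im w)\<^sup>2 \<le> 1" by (simp add: cmod_power2)
  moreover have "0 \<le> (Re w + 1)\<^sup>2 + (Im w)\<^sup>2" by simp
  ultimately show ?thesis
    by (simp add: Re_divide power2_eq_square algebra_simps divide_le_0_iff)
qed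

text \<open>
  On a circle of radius \<open>r < 1\<close> no denominator vanishes, and this is Cauchy's integral formula at the
  centre, with the circle parametrized by \<open>v\<close>.
\<close>

lemma circle_mean_exp_moebius_interior:
  fixes a :: "'i::finite \<Rightarrow> real" and b :: "'i \<Rightarrow> complex"
  assumes b: "\<And>j. norm (b j) = 1" and r: "0 < r" "r < 1"
  defines "F \<equiv> \<lambda>z::complex. exp (\<Sum>j\<in>UNIV. complex_of_real (a j) * ((z * b j - 1) / (z * b j + 1)))"
  shows "((\<lambda>v. F (complex_of_real r * exp (2 * pi * \<i> * of_real v))) has_integral complex_of_real (exp (- (\<Sum>j\<in>UNIV. a j)))) {0..1::real}"
proof -
  have "F holomorphic_on ball 0 1"
    unfolding F_def
  proof (intro holomorphic_intros)
    fix z j assume "z \<in> ball (0::complex) 1"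
    then have "norm (z * b j) < 1" using b by (simp add: norm_mult)
    then show "z * b j + 1 \<noteq> 0" by (metis add_eq_0_iff2 less_irrefl norm_minus_cancel norm_one)
  qed
  then have "F holomorphic_on cball 0 r" by (rule holomorphic_on_subset) (use r in auto)
  then have "((\<lambda>u. F u/(u-0)) has_contour_integral (2 * of_real pi * \<i> * F 0)) (circlepath 0 r)"
    by (rule Cauchy_integral_circlepath_simple) (use r in auto)
  then have "((\<lambda>v. F (circlepath 0 r v) / circlepath 0 r v * vector_derivative (circlepath 0 r) (at v within {0..1}))
     has_integral (2 * of_real pi * \<i> * F 0)) {0..1}"
    by (simp add: has_contour_integral_def)
  then have "((\<lambda>v. 2 * of_real pi * \<i> * F (r * exp (2 * pi * \<i> * of_real v))) has_integral (2 * of_real pi * \<i> * F 0)) {0..1}"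
    by (rule has_integral_eq[rotated]) (use r in \<open>simp add: vector_derivative_circlepath01, simp add: circlepath\<close>)
  from has_integral_mult_right[OF this, of "1 / (2 * of_real pi * \<i>)"]
  have "((\<lambda>v. F (r * exp (2 * pi * \<i> * of_real v))) has_integral F 0) {0..1}"
    by (simp add: field_simps)
  moreover have "F 0 = complex_of_real (exp (- (\<Sum>j\<in>UNIV. a j)))"
    by (simp add: F_def sum_negf flip: exp_of_real)
  ultimately show ?thesis by simp
qed

lemma finite_circle_preimage: "finite {v\<in>{0..1::real}. exp (2 * pi * \<i> * of_real v) = z}"
proof -
  have "{v\<in>{0..<1::real}. exp (2 * pi * \<i> * of_real v) = z} \<subseteq> {u}"
    if u: "u \<in> {0..<1}" "exp (2 * pi * \<i> * of_real u) = z" for u :: real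
  proof safe
    fix v :: real assume v: "v \<in> {0..<1}" "z = exp (2 * pi * \<i> * of_real v)"
    then have "exp (2 * pi * \<i> * of_real v) = exp (2 * pi * \<i> * of_real u)" using u by simp
    then obtain n :: int where "2 * pi * \<i> * v = 2 * pi * \<i> * u + (of_int (2 * n) * pi) * \<i>"
      by (auto simp: exp_eq)
    then have "Im (2 * pi * \<i> * v) = Im (2 * pi * \<i> * u + (of_int (2 * n) * pi) * \<i>)" by (rule arg_cong)
    then have "pi * (v - u - n) = 0" by (simp add: algebra_simps)
    then have "v - u = n" by simp
    then have "n = 0" using v u by simp
    then show "v = u" using \<open>v - u = n\<close> by simp
  qed
  then have "finite {v\<in>{0..<1::real}. exp (2 * pi * \<i> * of_real v) = z}"
    by (cases "{v\<in>{0..<1::real}. exp (2 * pi * \<i> * of_real v) = z} = {}") (auto intro: finite_subset)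
  then show ?thesis
    by (rule finite_subset[rotated, OF finite_insert[THEN iffD2, of _ 1]]) force
qed

text \<open>
  The integrand has at most as many discontinuities on the unit circle as there are factors, and it is
  bounded by 1 on the closed disc because the exponent has nonpositive real part. So the mean over the
  circle of radius \<open>r\<close> converges to the mean over the unit circle as \<open>r\<close> tends to 1.
\<close>

lemma circle_mean_exp_moebius:
  fixes a :: "'i::finite \<Rightarrow> real" and b :: "'i \<Rightarrow> complex"
  assumes b: "\<And>j. norm (b j) = 1" and a: "\<And>j. 0 \<le> a j"
  defines "F \<equiv> \<lambda>z::complex. exp (\<Sum>j\<in>UNIV. complex_of_real (a j) * ((z * b j - 1) / (z * b j + 1)))"
  shows "(CLINT v:{0..1}|lborel. F (exp (2 * pi * \<i> * of_real v))) = complex_of_real (exp (- (\<Sum>j\<in>UNIV. a j)))"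
proof -
  define r where "r n = 1 - 1 / (real n + 2)" for n
  have r: "0 < r n" "r n < 1" for n by (auto simp: r_def field_simps)
  have rlim: "r \<longlonglongrightarrow> 1" unfolding r_def by real_asymp
  have Re_real_mult: "Re (complex_of_real c * w) = c * Re w" for c w
    by simp
  have F1: "norm (F z) \<le> 1" if "norm z \<le> 1" for z
  proof -
    have "Re (complex_of_real (a j) * ((z * b j - 1) / (z * b j + 1))) \<le> 0" for j
    proof -
      have "Re (complex_of_real (a j) * ((z * b j - 1) / (z * b j + 1)))
          = a j * Re ((z * b j - 1) / (z * b j + 1))"
        by (rule Re_real_mult)
      also have "\<dots> \<le> 0"
        using that b by (intro mult_nonneg_nonpos a Re_moebius_nonpos) (simp add: norm_mult)
      finally show ?thesis .
    qed
    then show ?thesis unfolding F_def norm_exp_eq_Re by (auto simp: Re_sum intro!: sum_nonpos)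
  qed
  have [measurable]: "F \<in> borel_measurable borel"
    unfolding F_def by measurable
  have mean: "(CLINT v:{0..1}|lborel. F (r n * exp (2 * pi * \<i> * of_real v))) = complex_of_real (exp (- (\<Sum>j\<in>UNIV. a j)))" for n
  proof -
    have "set_integrable lborel {0..1} (\<lambda>v. F (r n * exp (2 * pi * \<i> * of_real v)))"
    proof (rule set_integrable_bound[where f="\<lambda>_. 1::real"])
      show "AE x in lborel. x \<in> {0..1} \<longrightarrow> norm (F (r n * exp (2 * pi * \<i> * of_real x))) \<le> norm (1::real)"
        using r[of n] by (auto intro!: F1 simp: norm_mult)
    qed (auto simp: set_integrable_def set_borel_measurable_def)
    from set_borel_integral_eq_integral(2)[OF this]
    show ?thesis using circle_mean_exp_moebius_interior[OF b r, of a n] unfolding F_def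
      by (simp add: integral_unique)
  qed
  have "(\<lambda>n. CLINT v:{0..1}|lborel. F (r n * exp (2 * pi * \<i> * of_real v))) \<longlonglongrightarrow> (CLINT v:{0..1}|lborel. F (exp (2 * pi * \<i> * of_real v)))"
    unfolding set_lebesgue_integral_def
  proof (rule integral_dominated_convergence[where w="indicator {0..1}"])
    \<comment> \<open>Convergence can fail only where some denominator vanishes on the unit circle.\<close>
    have "finite (\<Union>j. {v\<in>{0..1::real}. exp (2 * pi * \<i> * of_real v) = - 1 / b j})"
      by (intro finite_UN_I finite_circle_preimage) simp
    then have "AE v in lborel. v \<notin> (\<Union>j. {v\<in>{0..1::real}. exp (2 * pi * \<i> * of_real v) = - 1 / b j})"
      by (intro AE_not_in finite_imp_null_set_lborel)
    then show "AE v in lborel. (\<lambda>n. indicat_real {0..1} v *\<^sub>R F (r n * exp (2 * pi * \<i> * of_real v)))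
         \<longlonglongrightarrow> indicat_real {0..1} v *\<^sub>R F (exp (2 * pi * \<i> * of_real v))"
    proof eventually_elim
      case (elim v)
      show ?case
      proof (cases "v \<in> {0..1}")
        case True
        have "exp (2 * pi * \<i> * of_real v) * b j + 1 \<noteq> 0" for j
        proof
          assume "exp (2 * pi * \<i> * of_real v) * b j + 1 = 0"
          then have "exp (2 * pi * \<i> * of_real v) * b j = - 1" by (simp add: add_eq_0_iff2)
          moreover have "b j \<noteq> 0" using b[of j] by auto
          ultimately have "exp (2 * pi * \<i> * of_real v) = - 1 / b j" by (simp only: nonzero_eq_divide_eq not_False_eq_True)
          then show False using elim True by blast
        qed
        then have "isCont F (exp (2 * pi * \<i> * of_real v))"
          unfolding F_def by (intro continuous_intros) auto
        moreover have "(\<lambda>n. complex_of_real (r n) * exp (2 * pi * \<i> * of_real v)) \<longlonglongrightarrow> of_real 1 * exp (2 * pi * \<i> * of_real v)"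
          by (intro tendsto_intros rlim)
        ultimately show ?thesis
          by (intro tendsto_intros isCont_tendsto_compose[of _ F]) auto
      qed simp
    qed
    show "AE x in lborel. norm (indicat_real {0..1} x *\<^sub>R F (complex_of_real (r n) * exp (2 * pi * \<i> * of_real x))) \<le> indicator {0..1} x" for n
      using r[of n] by (auto intro!: F1 AE_I2 simp: norm_mult indicator_def)
  qed auto
  then show ?thesis unfolding mean by (simp add: LIMSEQ_const_iff)
qed

section \<open>Ratios of independent Gaussian vectors\<close>

text \<open>
  For \<open>w\<close> of argument \<open>\<theta>\<close> the left side is the Moebius map at \<open>exp (2 * \<i> * \<theta>)\<close> and the right side is
  \<open>\<i> * tan \<theta>\<close>. For imaginary \<open>w\<close> both sides are a division by zero, so they still agree.
\<close>

lemma moebius_unit_eq_tangent: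
  assumes "w \<noteq> 0"
  shows "(w / cnj w - 1) / (w / cnj w + 1) = \<i> * complex_of_real (Im w / Re w)"
proof -
  have "(w / cnj w - 1) / (w / cnj w + 1) = (w - cnj w) / (w + cnj w)"
    using assms by (simp add: divide_simps)
  also have "\<dots> = (2 * \<i> * Im w) / (2 * Re w)"
    by (simp add: complex_diff_cnj complex_add_cnj mult_ac)
  finally show ?thesis by simp
qed

lemma prob_space_centered_gaussian:
  assumes "centered_gaussian \<Sigma> N"
  shows "prob_space N" "sets N = sets borel"
  using assms by (simp_all add: centered_gaussian_def)

lemma char_gaussian_pair:
  assumes G: "centered_gaussian \<Sigma> N"
  shows "(CLINT p|N \<Otimes>\<^sub>M N. iexp (s \<bullet> fst p + t \<bullet> snd p))
     = exp (- complex_of_real (s \<bullet> (\<Sigma> *v s) + t \<bullet> (\<Sigma> *v t)) / 2)"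
proof -
  note [measurable_cong] = prob_space_centered_gaussian(2)[OF G]
  interpret N: prob_space N by (rule prob_space_centered_gaussian[OF G])
  interpret P: pair_prob_space N N ..
  have "(CLINT p|N \<Otimes>\<^sub>M N. iexp (s \<bullet> fst p + t \<bullet> snd p)) = (CLINT x|N. CLINT y|N. iexp (s \<bullet> x + t \<bullet> y))"
    by (subst P.integral_fst'[symmetric]) (auto intro!: P.integrable_const_bound[of _ 1])
  also have "\<dots> = (CLINT x|N. iexp (s \<bullet> x)) * (CLINT y|N. iexp (t \<bullet> y))"
    by (simp add: exp_add distrib_left)
  also have "\<dots> = exp (- complex_of_real (s \<bullet> (\<Sigma> *v s) + t \<bullet> (\<Sigma> *v t)) / 2)"
    using G by (simp add: centered_gaussian_def exp_add[symmetric] field_simps)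
  finally show ?thesis .
qed

definition rotate_pair :: "real \<Rightarrow> 'a \<times> 'a \<Rightarrow> 'a \<times> 'a::real_vector" where
  "rotate_pair u p = (cos u *\<^sub>R fst p - sin u *\<^sub>R snd p, sin u *\<^sub>R fst p + cos u *\<^sub>R snd p)"

lemma borel_measurable_fst_snd:
  fixes p :: "'b \<Rightarrow> 'a::euclidean_space \<times> 'a"
  assumes p: "p \<in> borel_measurable M"
  shows "(\<lambda>x. fst (p x)) \<in> borel_measurable M" "(\<lambda>x. snd (p x)) \<in> borel_measurable M"
  by (auto intro!: measurable_compose[OF p] borel_measurable_continuous_onI continuous_intros)

lemma measurable_rotate_pair [measurable]:
  fixes u :: "'b \<Rightarrow> real" and p :: "'b \<Rightarrow> 'a::euclidean_space \<times> 'a"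
  assumes [measurable]: "u \<in> borel_measurable M" "p \<in> borel_measurable M"
  shows "(\<lambda>x. rotate_pair (u x) (p x)) \<in> borel_measurable M"
proof -
  note [measurable] = borel_measurable_fst_snd[OF assms(2)]
  show ?thesis unfolding rotate_pair_def by (intro borel_measurable_Pair; measurable)
qed

lemma sets_gaussian_pair:
  "centered_gaussian \<Sigma> N \<Longrightarrow> sets (N \<Otimes>\<^sub>M N) = sets borel"
  by (subst borel_prod[symmetric]) (intro sets_pair_measure_cong; simp add: centered_gaussian_def)

text \<open>
  A rotation by \<open>u\<close> acts on the frequencies by the inverse rotation, and the quadratic form
  \<open>t1 \<bullet> (\<Sigma> *v t1) + t2 \<bullet> (\<Sigma> *v t2)\<close> in the exponent of the characteristic function is invariant under it,
  since the cross terms cancel.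
\<close>

lemma gaussian_pair_rotation_invariant:
  assumes G: "centered_gaussian \<Sigma> N"
  shows "distr (N \<Otimes>\<^sub>M N) borel (rotate_pair u) = N \<Otimes>\<^sub>M N"
proof (rule char_unique_euclidean)
  note [measurable_cong] = prob_space_centered_gaussian(2)[OF G]
  interpret N: prob_space N by (rule prob_space_centered_gaussian[OF G])
  interpret P: pair_prob_space N N ..
  note [measurable_cong] = sets_gaussian_pair[OF G]
  show "prob_space (distr (N \<Otimes>\<^sub>M N) borel (rotate_pair u))"
    by (rule P.prob_space_distr) measurable
  show "prob_space (N \<Otimes>\<^sub>M N)" by (rule P.prob_space_axioms)
  fix t :: "(real^'a) \<times> (real^'a)"
  obtain t1 t2 where t: "t = (t1, t2)" by (cases t)
  let ?q = "\<lambda>t. t \<bullet> (\<Sigma> *v t)"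
  have "(CLINT x|distr (N \<Otimes>\<^sub>M N) borel (rotate_pair u). iexp (t \<bullet> x))
     = (CLINT p|N \<Otimes>\<^sub>M N. iexp ((cos u *\<^sub>R t1 + sin u *\<^sub>R t2) \<bullet> fst p + (cos u *\<^sub>R t2 - sin u *\<^sub>R t1) \<bullet> snd p))"
  proof (subst integral_distr)
    show "rotate_pair u \<in> borel_measurable (N \<Otimes>\<^sub>M N)" "(\<lambda>x. iexp (t \<bullet> x)) \<in> borel_measurable borel"
      by measurable
  qed (simp add: rotate_pair_def inner_prod_def t algebra_simps)
  also have "\<dots> = exp (- complex_of_real (?q (cos u *\<^sub>R t1 + sin u *\<^sub>R t2) + ?q (cos u *\<^sub>R t2 - sin u *\<^sub>R t1)) / 2)"
    by (rule char_gaussian_pair[OF G])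
  also have "?q (cos u *\<^sub>R t1 + sin u *\<^sub>R t2) + ?q (cos u *\<^sub>R t2 - sin u *\<^sub>R t1)
     = ((cos u)\<^sup>2 + (sin u)\<^sup>2) * (?q t1 + ?q t2)"
    by (simp add: matrix_vector_right_distrib matrix_vector_mult_diff_distrib matrix_vector_mult_scaleR
       inner_add_left inner_add_right inner_diff_left inner_diff_right algebra_simps power2_eq_square
       del: sin_cos_squared_add sin_cos_squared_add2 sin_cos_squared_add3)
  also have "exp (- complex_of_real (((cos u)\<^sup>2 + (sin u)\<^sup>2) * (?q t1 + ?q t2)) / 2)
      = (CLINT p|N \<Otimes>\<^sub>M N. iexp (t1 \<bullet> fst p + t2 \<bullet> snd p))"
    by (subst char_gaussian_pair[OF G]) simp
  also have "\<dots> = (CLINT p|N \<Otimes>\<^sub>M N. iexp (t \<bullet> p))" by (simp add: inner_prod_def t)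
  finally show "(CLINT x|distr (N \<Otimes>\<^sub>M N) borel (rotate_pair u). iexp (t \<bullet> x)) = (CLINT p|N \<Otimes>\<^sub>M N. iexp (t \<bullet> p))" .
qed (simp_all add: sets_gaussian_pair[OF G])

text \<open>
  The coordinate is a normal variable of positive variance, hence has no atoms. Since \<open>N\<close> is only known
  through its characteristic function, this is read off from the law of the coordinate.
\<close>

lemma gaussian_coord_nonzero:
  assumes G: "centered_gaussian \<Sigma> N" and pos: "0 < \<Sigma>$j$j"
  shows "AE x in N. x$j \<noteq> 0"
proof -
  note [measurable_cong] = prob_space_centered_gaussian(2)[OF G]
  interpret N: prob_space N by (rule prob_space_centered_gaussian[OF G])
  interpret Z: real_distribution std_normal_distribution by (rule real_dist_normal_dist)
  let ?s = "sqrt (\<Sigma>$j$j)"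
  have "distr N borel (\<lambda>x. x$j) = distr std_normal_distribution borel (\<lambda>z. ?s * z)"
  proof (rule Levy_uniqueness[OF N.real_distribution_distr Z.real_distribution_distr])
    show "char (distr N borel (\<lambda>x. x$j)) = char (distr std_normal_distribution borel (\<lambda>z. ?s * z))"
    proof
      fix t
      have "char (distr N borel (\<lambda>x. x$j)) t = (CLINT x|N. iexp ((t *\<^sub>R axis j 1) \<bullet> x))"
        unfolding char_def by (subst integral_distr) (auto simp: inner_axis')
      also have "\<dots> = exp (- complex_of_real ((t *\<^sub>R axis j 1) \<bullet> (\<Sigma> *v (t *\<^sub>R axis j 1))) / 2)"
        using G unfolding centered_gaussian_def by blast
      also have "(t *\<^sub>R axis j 1) \<bullet> (\<Sigma> *v (t *\<^sub>R axis j 1)) = (t * ?s)\<^sup>2"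
        using pos by (simp add: matrix_vector_mult_scaleR inner_axis' matrix_vector_mult_basis column_def power2_eq_square)
      also have "exp (- complex_of_real ((t * ?s)\<^sup>2) / 2) = char std_normal_distribution (t * ?s)"
        by (simp add: char_std_normal_distribution flip: exp_of_real)
      also have "\<dots> = char (distr std_normal_distribution borel (\<lambda>z. ?s * z)) t"
        unfolding char_def by (subst integral_distr) (auto simp: mult_ac)
      finally show "char (distr N borel (\<lambda>x. x$j)) t = char (distr std_normal_distribution borel (\<lambda>z. ?s * z)) t" .
    qed
  qed measurable
  moreover have "AE z in std_normal_distribution. ?s * z \<noteq> 0"
    using pos AE_lborel_singleton[of 0] by (subst AE_density) auto
  then have "AE y in distr std_normal_distribution borel (\<lambda>z. ?s * z). y \<noteq> 0"
    by (subst AE_distr_iff) auto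
  ultimately have "AE y in distr N borel (\<lambda>x. x$j). y \<noteq> 0" by (simp only:)
  then show ?thesis by (subst (asm) AE_distr_iff) auto
qed

text \<open>
  As a quadratic form of \<open>\<Sigma>\<close>, the reciprocal of the Wald statistic is the variance of a linear
  combination of Gaussian coordinates; so its Laplace transform averages characteristic functions.
\<close>

definition inverse_wald :: "real^'m \<Rightarrow> real^'m^'m \<Rightarrow> real^'m \<Rightarrow> real" where
  "inverse_wald a \<Sigma> x = (\<chi> j. a$j / x$j) \<bullet> (\<Sigma> *v (\<chi> j. a$j / x$j))"

lemma wald_monomial_eq_inverse: "wald_monomial a \<Sigma> x = inverse (inverse_wald a \<Sigma> x)"
  by (simp add: wald_monomial_def inverse_wald_def inner_vec_def matrix_vector_mult_def sum_distrib_left mult_ac)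

lemma measurable_inverse_wald [measurable]: "inverse_wald a \<Sigma> \<in> borel_measurable borel"
  unfolding inverse_wald_def inner_vec_def matrix_vector_mult_def by simp

text \<open>
  Averaged over a common rotation of the pairs \<open>(x$j, y$j)\<close>, the exponential of the ratio sum no longer
  depends on \<open>x\<close> and \<open>y\<close>. Each pair is the complex number \<open>c j\<close>, and rotation multiplies it by a
  unimodular factor. An angle between 0 and \<open>pi\<close> suffices, because ratios have period \<open>pi\<close>; its
  double runs once through the circle.
\<close>

lemma mean_rotated_ratio:
  fixes x y a :: "real^'m"
  assumes x: "\<And>j. x$j \<noteq> 0" and a: "\<And>j. 0 \<le> a$j" and t: "0 \<le> t"
  shows "(CLINT v:{0..1}|lborel. iexp (t * (\<Sum>j\<in>UNIV. a$j * (snd (rotate_pair (pi * v) (x, y)) $ j / fst (rotate_pair (pi * v) (x, y)) $ j))))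
      = complex_of_real (exp (- (t * (\<Sum>j\<in>UNIV. a$j))))"
proof -
  define c where "c j = Complex (x$j) (y$j)" for j
  define b where "b j = c j / cnj (c j)" for j
  have c: "c j \<noteq> 0" for j using x[of j] by (auto simp: c_def complex_eq_iff)
  have b: "norm (b j) = 1" for j using c[of j] by (simp add: b_def norm_divide)
  have "iexp (t * (\<Sum>j\<in>UNIV. a$j * (snd (rotate_pair (pi * v) (x, y)) $ j / fst (rotate_pair (pi * v) (x, y)) $ j)))
     = exp (\<Sum>j\<in>UNIV. complex_of_real (t * a$j) * ((exp (2 * pi * \<i> * of_real v) * b j - 1) / (exp (2 * pi * \<i> * of_real v) * b j + 1)))" for v
  proof -
    have "(exp (2 * pi * \<i> * of_real v) * b j - 1) / (exp (2 * pi * \<i> * of_real v) * b j + 1)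
       = \<i> * complex_of_real (snd (rotate_pair (pi * v) (x, y)) $ j / fst (rotate_pair (pi * v) (x, y)) $ j)" for j
    proof -
      define w where "w = cis (pi * v) * c j"
      have "w \<noteq> 0" using c by (simp add: w_def)
      have "exp (2 * pi * \<i> * of_real v) = cis (pi * v) * cis (pi * v)"
        by (simp add: cis_mult) (simp add: cis_conv_exp mult_ac)
      then have "exp (2 * pi * \<i> * of_real v) * b j = w / cnj w"
        by (simp add: w_def b_def cis_cnj divide_inverse)
      moreover have "Re w = fst (rotate_pair (pi * v) (x, y)) $ j" "Im w = snd (rotate_pair (pi * v) (x, y)) $ j"
        by (simp_all add: w_def c_def rotate_pair_def)
      ultimately show ?thesis using moebius_unit_eq_tangent[OF \<open>w \<noteq> 0\<close>] by simp
    qed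
    moreover have "\<i> * complex_of_real (t * (\<Sum>j\<in>UNIV. a$j * R j))
        = (\<Sum>j\<in>UNIV. complex_of_real (t * a$j) * (\<i> * complex_of_real (R j)))" for R :: "'m \<Rightarrow> real"
      by (simp add: sum_distrib_left mult_ac)
    ultimately show ?thesis by (simp only:)
  qed
  then show ?thesis
    using circle_mean_exp_moebius[of b "\<lambda>j. t * a$j", OF b] a t by (simp add: sum_distrib_left)
qed

text \<open>
  The characteristic function at \<open>t\<close> of the ratio sum of two independent copies is computed twice:
  conditionally on the denominators, and by averaging over rotations.
\<close>

lemma laplace_inverse_wald:
  fixes a :: "real^'m"
  assumes G: "centered_gaussian \<Sigma> N" and pos: "\<And>j. 0 < \<Sigma>$j$j" and a: "\<And>j. 0 \<le> a$j" and t: "0 \<le> t"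
  shows "(LINT x|N. exp (- (t\<^sup>2 / 2 * inverse_wald a \<Sigma> x))) = exp (- (t * (\<Sum>j\<in>UNIV. a$j)))"
proof -
  note [measurable_cong] = prob_space_centered_gaussian(2)[OF G]
  interpret N: prob_space N by (rule prob_space_centered_gaussian[OF G])
  interpret P: pair_prob_space N N ..
  note [measurable_cong] = sets_gaussian_pair[OF G]
  define f where "f p = iexp (t * (\<Sum>j\<in>UNIV. a$j * (snd p $ j / fst p $ j)))" for p :: "(real^'m) \<times> (real^'m)"
  have [measurable]: "f \<in> borel_measurable borel"
  proof -
    note [measurable] = borel_measurable_fst_snd[of "\<lambda>p. p", OF measurable_ident_sets[OF refl]]
    have [measurable]: "(\<lambda>p. fst p $ j) \<in> borel_measurable (borel :: ((real^'m) \<times> (real^'m)) measure)"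
       "(\<lambda>p. snd p $ j) \<in> borel_measurable (borel :: ((real^'m) \<times> (real^'m)) measure)" for j
      by (auto intro!: borel_measurable_continuous_onI continuous_intros)
    show ?thesis unfolding f_def by measurable
  qed
  have f1: "norm (f p) = 1" for p by (simp add: f_def)
  have intf: "integrable (N \<Otimes>\<^sub>M N) f" by (rule P.integrable_const_bound[of _ 1]) (auto simp: f1)
  \<comment> \<open>For fixed denominators \<open>x\<close>, the inner integral is the characteristic function of \<open>N\<close>.\<close>
  have "(CLINT p|N \<Otimes>\<^sub>M N. f p) = (CLINT x|N. CLINT y|N. f (x, y))"
    by (rule P.integral_fst'[symmetric]) (fact intf)
  also have "\<dots> = (CLINT x|N. complex_of_real (exp (- (t\<^sup>2 / 2 * inverse_wald a \<Sigma> x))))"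
  proof (rule Bochner_Integration.integral_cong[OF refl])
    fix x :: "real^'m"
    define w where "w = (\<chi> j. a$j / x$j)"
    have "(CLINT y|N. f (x, y)) = (CLINT y|N. iexp ((t *\<^sub>R w) \<bullet> y))"
      by (simp add: f_def w_def inner_vec_def sum_distrib_left mult_ac)
    also have "\<dots> = exp (- complex_of_real ((t *\<^sub>R w) \<bullet> (\<Sigma> *v (t *\<^sub>R w))) / 2)"
      using G unfolding centered_gaussian_def by blast
    also have "(t *\<^sub>R w) \<bullet> (\<Sigma> *v (t *\<^sub>R w)) = t\<^sup>2 * inverse_wald a \<Sigma> x"
      by (simp add: inverse_wald_def w_def matrix_vector_mult_scaleR power2_eq_square)
    finally show "(CLINT y|N. f (x, y)) = complex_of_real (exp (- (t\<^sup>2 / 2 * inverse_wald a \<Sigma> x)))"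
      by (simp flip: exp_of_real)
  qed
  finally have 1: "(CLINT p|N \<Otimes>\<^sub>M N. f p) = complex_of_real (LINT x|N. exp (- (t\<^sup>2 / 2 * inverse_wald a \<Sigma> x)))"
    by simp
  have rot: "(CLINT p|N \<Otimes>\<^sub>M N. f (rotate_pair u p)) = (CLINT p|N \<Otimes>\<^sub>M N. f p)" for u
  proof -
    have "(CLINT p|N \<Otimes>\<^sub>M N. f p) = (CLINT p|distr (N \<Otimes>\<^sub>M N) borel (rotate_pair u). f p)"
      by (simp add: gaussian_pair_rotation_invariant[OF G])
    also have "\<dots> = (CLINT p|N \<Otimes>\<^sub>M N. f (rotate_pair u p))"
      by (rule integral_distr) measurable
    finally show ?thesis ..
  qed
  have nz: "AE p in N \<Otimes>\<^sub>M N. \<forall>j. fst p $ j \<noteq> 0"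
  proof -
    have "AE p in N \<Otimes>\<^sub>M N. fst p $ j \<noteq> 0" for j
    proof (rule P.AE_pair_measure)
      have "(\<lambda>x. x $ j) \<in> borel_measurable N" by measurable
      from measurable_compose[OF measurable_fst this]
      have [measurable]: "(\<lambda>p. fst p $ j) \<in> borel_measurable (N \<Otimes>\<^sub>M N)" .
      show "{p \<in> space (N \<Otimes>\<^sub>M N). fst p $ j \<noteq> 0} \<in> sets (N \<Otimes>\<^sub>M N)"
        by measurable
    qed (use gaussian_coord_nonzero[OF G pos, of j] in simp)
    then show ?thesis by (simp add: AE_all_countable)
  qed
  define U where "U = restrict_space lborel {0..1::real}"
  interpret U: prob_space U unfolding U_def by (rule prob_space_restrict_space) auto
  have [measurable]: "(\<lambda>v. v) \<in> borel_measurable U"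
    unfolding U_def by (rule measurable_restrict_space1) simp
  interpret UP: pair_prob_space U "N \<Otimes>\<^sub>M N" ..
  have "(CLINT p|N \<Otimes>\<^sub>M N. f p) = (CLINT v|U. CLINT p|N \<Otimes>\<^sub>M N. f (rotate_pair (pi * v) p))"
    unfolding rot by (simp add: U.prob_space)
  also have "\<dots> = (CLINT p|N \<Otimes>\<^sub>M N. CLINT v|U. f (rotate_pair (pi * v) p))"
    by (rule UP.Fubini_integral[symmetric]) (auto intro!: UP.integrable_const_bound[of _ 1] simp: f1 split_beta)
  also have "\<dots> = (CLINT p|N \<Otimes>\<^sub>M N. complex_of_real (exp (- (t * (\<Sum>j\<in>UNIV. a$j)))))"
  proof (rule integral_cong_AE)
    show "AE p in N \<Otimes>\<^sub>M N. (CLINT v|U. f (rotate_pair (pi * v) p)) = complex_of_real (exp (- (t * (\<Sum>j\<in>UNIV. a$j))))"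
      using nz
    proof eventually_elim
      case (elim p)
      show ?case
        using mean_rotated_ratio[of "fst p" a t "snd p"] elim a t
        unfolding U_def f_def by (subst integral_restrict_space) (simp_all add: set_lebesgue_integral_def)
    qed
  qed measurable
  also have "\<dots> = complex_of_real (exp (- (t * (\<Sum>j\<in>UNIV. a$j))))"
    by (simp add: P.prob_space)
  finally show ?thesis using 1 by (metis of_real_eq_iff)
qed

section \<open>Laplace transforms determine distributions\<close>

text \<open>
  The exponential series may be integrated term by term, because for \<open>\<bar>x\<bar> \<le> 1\<close> its terms are
  dominated by those of the series of \<open>exp \<bar>t\<bar>\<close>.
\<close>

lemma char_sums_moments:
  fixes M :: "real measure"
  assumes M: "prob_space M" "sets M = sets borel" and b: "AE x in M. \<bar>x\<bar> \<le> 1"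
  shows "(\<lambda>n. (\<i> * complex_of_real t) ^ n / fact n * complex_of_real (LINT x|M. x ^ n)) sums char M t"
proof -
  note [measurable_cong] = M(2)
  interpret prob_space M by fact
  define f where "f n x = (\<i> * complex_of_real t) ^ n / fact n * complex_of_real (x ^ n)" for n x
  have nf: "norm (f n x) = \<bar>t\<bar> ^ n / fact n * \<bar>x\<bar> ^ n" for n x
    by (simp add: f_def norm_mult norm_divide norm_power power_abs)
  have bn: "AE x in M. norm (x ^ n) \<le> 1" "AE x in M. norm (\<bar>x\<bar> ^ n) \<le> 1" for n
    using b by (auto elim!: eventually_mono simp: power_abs power_le_one)
  have ip: "integrable M (\<lambda>x. x ^ n)" for n
    by (rule integrable_const_bound[of _ 1], rule bn) simp
  have ia: "integrable M (\<lambda>x. \<bar>x\<bar> ^ n)" for n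
    by (rule integrable_const_bound[of _ 1], rule bn) simp
  have fs: "f n x = (\<i> * complex_of_real (t * x)) ^ n /\<^sub>R fact n" for n x
    by (simp add: f_def power_mult_distrib scaleR_conv_of_real divide_inverse mult_ac)
  have "(\<lambda>n. integral\<^sup>L M (f n)) sums (CLINT x|M. (\<Sum>n. f n x))"
  proof (rule sums_integral)
    show "integrable M (f n)" for n
      unfolding f_def using ip by (intro integrable_mult_right integrable_of_real) auto
    show "AE x in M. summable (\<lambda>n. norm (f n x))"
      unfolding fs using summable_norm_exp by (intro AE_I2) blast
    show "summable (\<lambda>n. LINT x|M. norm (f n x))"
    proof (rule summable_comparison_test'[where N=0])
      show "summable (\<lambda>n. \<bar>t\<bar> ^ n /\<^sub>R fact n)" by (rule summable_exp_generic)
      fix n :: nat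
      have "(LINT x|M. norm (f n x)) = \<bar>t\<bar> ^ n / fact n * (LINT x|M. \<bar>x\<bar> ^ n)"
        unfolding nf by simp
      moreover have "(LINT x|M. \<bar>x\<bar> ^ n) \<le> (LINT x|M. 1)"
        using bn(2)[of n] by (intro integral_mono_AE ia) (auto elim!: eventually_mono)
      moreover have "0 \<le> (LINT x|M. \<bar>x\<bar> ^ n)" by (intro integral_nonneg_AE) simp
      ultimately show "norm (LINT x|M. norm (f n x)) \<le> \<bar>t\<bar> ^ n /\<^sub>R fact n"
        using mult_left_mono[of "LINT x|M. \<bar>x\<bar> ^ n" 1 "\<bar>t\<bar> ^ n / fact n"]
        by (simp add: prob_space divide_inverse mult_ac)
    qed
  qed
  moreover have "(\<Sum>n. f n x) = iexp (t * x)" for x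
    unfolding fs exp_def by simp
  moreover have "integral\<^sup>L M (f n) = (\<i> * complex_of_real t) ^ n / fact n * complex_of_real (LINT x|M. x ^ n)" for n
    unfolding f_def by (simp only: integral_mult_right_zero integral_complex_of_real)
  ultimately show ?thesis by (simp add: char_def)
qed

text \<open>
  The Laplace transform at the natural numbers lists the moments of \<open>exp (- X)\<close>, a variable with
  values in the unit interval. Its characteristic function is therefore the exponential series in
  these moments, and its law determines that of \<open>X\<close> through the logarithm.
\<close>

lemma distr_eq_if_laplace_eq:
  fixes X :: "'a \<Rightarrow> real" and Y :: "'b \<Rightarrow> real"
  assumes M: "prob_space M" and N: "prob_space N"
    and [measurable]: "X \<in> borel_measurable M" "Y \<in> borel_measurable N"
    and X: "\<And>x. 0 \<le> X x" and Y: "\<And>y. 0 \<le> Y y"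
    and eq: "\<And>n::nat. (LINT x|M. exp (- (real n * X x))) = (LINT y|N. exp (- (real n * Y y)))"
  shows "distr M borel X = distr N borel Y"
proof -
  interpret M: prob_space M by fact
  interpret N: prob_space N by fact
  let ?V = "distr M borel (\<lambda>x. exp (- X x))" and ?W = "distr N borel (\<lambda>x. exp (- Y x))"
  have V: "real_distribution ?V" and W: "real_distribution ?W"
    by (rule M.real_distribution_distr N.real_distribution_distr; measurable)+
  have "char ?V t = char ?W t" for t
  proof (rule sums_unique2)
    have "(LINT x|?V. x ^ n) = (LINT x|?W. x ^ n)" for n
      using eq[of n] by (subst (1 2) integral_distr) (auto simp flip: exp_of_nat_mult)
    then show "(\<lambda>n. (\<i> * complex_of_real t) ^ n / fact n * complex_of_real (LINT x|?V. x ^ n)) sums char ?W t"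
      using W Y by (simp only:) (intro char_sums_moments; auto simp: AE_distr_iff real_distribution_def)
    show "(\<lambda>n. (\<i> * complex_of_real t) ^ n / fact n * complex_of_real (LINT x|?V. x ^ n)) sums char ?V t"
      using V X by (intro char_sums_moments) (auto simp: AE_distr_iff real_distribution_def)
  qed
  then have "?V = ?W" by (intro Levy_uniqueness V W ext)
  then have "distr ?V borel (\<lambda>v. - ln v) = distr ?W borel (\<lambda>v. - ln v)" by simp
  then show ?thesis by (simp add: distr_distr comp_def)
qed

section \<open>The distribution of the Wald statistic\<close>

lemma chi_squared_1: "chi_squared 1 = distr std_normal_distribution borel (\<lambda>z. z\<^sup>2)"
proof -
  let ?P = "\<Pi>\<^sub>M i\<in>{..<1::nat}. std_normal_distribution"
  have "prob_space std_normal_distribution"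
    using real_dist_normal_dist by (simp add: real_distribution_def)
  then have "distr ?P std_normal_distribution (\<lambda>\<omega>. \<omega> 0) = std_normal_distribution"
    by (intro distr_PiM_component) auto
  then have "distr std_normal_distribution borel (\<lambda>z. z\<^sup>2) = distr (distr ?P std_normal_distribution (\<lambda>\<omega>. \<omega> 0)) borel (\<lambda>z. z\<^sup>2)"
    by simp
  also have "\<dots> = distr ?P borel (\<lambda>\<omega>. (\<omega> 0)\<^sup>2)"
    by (subst distr_distr) (auto simp: comp_def)
  finally show ?thesis by (simp add: chi_squared_def lessThan_Suc)
qed

lemma borel_measurable_vec [measurable]: "vec \<in> borel_measurable (borel :: real measure)"
  by (rule borel_measurable_continuous_onI) (auto simp: vec_def continuous_on_component intro!: continuous_intros)

lemma centered_gaussian_std_normal: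
  "centered_gaussian (mat 1 :: real^1^1) (distr std_normal_distribution borel vec)"
proof -
  interpret Z: real_distribution std_normal_distribution by (rule real_dist_normal_dist)
  have "(CLINT x|distr std_normal_distribution borel vec. iexp (t \<bullet> x))
    = exp (- complex_of_real (t \<bullet> (mat 1 *v t)) / 2)" for t :: "real^1"
  proof -
    have "(CLINT x|distr std_normal_distribution borel vec. iexp (t \<bullet> x)) = char std_normal_distribution (t$1)"
      unfolding char_def by (subst integral_distr) (auto simp: inner_vec_def)
    also have "\<dots> = exp (- complex_of_real (t \<bullet> (mat 1 *v t)) / 2)"
      by (simp add: char_std_normal_distribution inner_vec_def power2_eq_square flip: exp_of_real)
    finally show ?thesis .
  qed
  then show ?thesis
    by (auto simp: centered_gaussian_def intro!: Z.prob_space_distr)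
qed

theorem theorem2p1:
  fixes \<Sigma> :: "real^'m^'m" and a :: "real^'m"
    and M :: "'w measure" and X :: "'w \<Rightarrow> real^'m"
  assumes "pos_semidef \<Sigma>"
    and "\<And>j. 0 < \<Sigma>$j$j"
    and "prob_space M"
    and "X \<in> borel_measurable M"
    and "centered_gaussian \<Sigma> (distr M borel X)"
    and "\<And>j. 0 \<le> a$j"
    and "0 < (\<Sum>j\<in>UNIV. a$j)"
  shows "distr M borel (\<lambda>\<omega>. wald_monomial a \<Sigma> (X \<omega>)) =
    distr (chi_squared 1) borel (\<lambda>y. 1 / (\<Sum>j\<in>UNIV. a$j)\<^sup>2 * y)"
proof -
  note [measurable] = assms(4)
  define A where "A = (\<Sum>j\<in>UNIV. a$j)"
  \<comment> \<open>\<open>?Z\<close> and \<open>?T\<close> are the one-dimensional instance with the single exponent \<open>A\<close>.\<close>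
  let ?N = "distr M borel X" and ?Z = "distr std_normal_distribution borel vec :: (real^1) measure"
  let ?S = "inverse_wald a \<Sigma>" and ?T = "inverse_wald (vec A) (mat 1 :: real^1^1)"
  have "distr ?N borel ?S = distr ?Z borel ?T"
  proof (rule distr_eq_if_laplace_eq)
    show "prob_space ?N" "prob_space ?Z"
      using assms(5) centered_gaussian_std_normal by (simp_all add: centered_gaussian_def)
    show "0 \<le> ?S x" for x
      using assms(1) by (simp add: inverse_wald_def pos_semidef_def)
    show "0 \<le> ?T x" for x
      by (simp add: inverse_wald_def)
    fix n :: nat
    \<comment> \<open>The Laplace variable is \<open>t\<^sup>2 / 2\<close>; take \<open>t\<close> so that it equals \<open>n\<close>.\<close>
    have n: "(sqrt (2 * n))\<^sup>2 / 2 = n" by simp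
    have "(LINT x|?N. exp (- (n * ?S x))) = exp (- (sqrt (2 * n) * A))"
      using laplace_inverse_wald[OF assms(5,2,6), of "sqrt (2 * n)"] unfolding n A_def by simp
    also have "\<dots> = (LINT x|?Z. exp (- (n * ?T x)))"
      using laplace_inverse_wald[OF centered_gaussian_std_normal, of "vec A" "sqrt (2 * n)"] assms(7)
      unfolding n by (simp add: A_def mat_def)
    finally show "(LINT x|?N. exp (- (n * ?S x))) = (LINT x|?Z. exp (- (n * ?T x)))" .
  qed measurable
  then have "distr (distr ?N borel ?S) borel inverse = distr (distr ?Z borel ?T) borel inverse"
    by simp
  then have "distr M borel (\<lambda>\<omega>. wald_monomial a \<Sigma> (X \<omega>)) = distr std_normal_distribution borel (\<lambda>z. inverse (?T (vec z)))"
    by (simp add: distr_distr comp_def wald_monomial_eq_inverse)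
  also have "(\<lambda>z. inverse (?T (vec z))) = (\<lambda>z. 1 / A\<^sup>2 * z\<^sup>2)"
    by (auto simp: inverse_wald_def inner_vec_def power2_eq_square)
  also have "distr std_normal_distribution borel (\<lambda>z. 1 / A\<^sup>2 * z\<^sup>2) = distr (chi_squared 1) borel (\<lambda>y. 1 / A\<^sup>2 * y)"
    unfolding chi_squared_1 by (simp add: distr_distr comp_def)
  finally show ?thesis by (simp add: A_def)
qed

end
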